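(* Let $D$ be the $n\times n$ boundary matrix, over a field $\mathbf{k}$, of a filtered cell complex. The decompositions $R_c=DV_c$ and $R_r=DV_r$ produced from input $D$ by the column algorithm and the row algorithm respectively are identical, i.e. $R_c=R_r$ and $V_c=V_r$.
   Context: A filtered cell complex is a sequence of cell complexes $X_1\subset\dots\subset X_n$ where $X_1$ is a vertex $\sigma_1$ and $X_i=X_{i-1}\cup\sigma_i$ with a single cell $\sigma_i$ added at each step. Its boundary matrix $D$ is the strictly upper-triangular $n\times n$ matrix with $\partial\sigma_j=\sum_{i<j}D[i,j]\sigma_i$ (so $D^2=0$). For a matrix $A$, $A[j]$ denotes its $j$-th column and $A[j][i]$ the entry of that column in row $i$. $\mathrm{low}_A(j)$ is the largest index $i$ such that the entry of $A$ in row $i$, column $j$ is nonzero; it is undefined if column $j$ is zero (and an equality $\mathrm{low}_A(j)=\mathrm{low}_A(i)$ is understood to require both sides to be defined). Column algorithm: - Initialise $R=D$, $V=I$. - For $i=1$ to $n$: while there exists $j<i$ with $\mathrm{low}_R(j)=\mathrm{low}_R(i)$, set $c=R[i][\mathrm{low}_R(i)]/R[j][\mathrm{low}_R(j)]$, then $R[i]:=R[i]-cR[j]$ and $V[i]:=V[i]-cV[j]$. The output is $(R_c,V_c)=(R,V)$. Row algorithm: - Initialise $R=D$, $V=I$. - For $i=n$ down to $1$: let $\mathrm{indices}$ be the list, in increasing order, of all $j$ with $\mathrm{low}_R(j)=i$. If it is nonempty, let $p$ be its first element (the pivot); for every other $j$ in $\mathrm{indices}$, set $c=R[j][\mathrm{low}_R(j)]/R[p][\mathrm{low}_R(p)]$,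 then $R[j]:=R[j]-cR[p]$ and $V[j]:=V[j]-cV[p]$. The output is $(R_r,V_r)=(R,V)$. *)

theory Defs
  imports "Jordan_Normal_Form.Column_Operations" "HOL-Library.While_Combinator"
begin

text \<open>
  A finite cell complex over a field is given by its set of cells \<open>K\<close>, their dimensions, and the
  cellular boundary: \<open>bd s t\<close> is the coefficient of the cell \<open>t\<close> in the boundary of the cell \<open>s\<close>.
  The first clause says that the boundary of a \<open>(d + 1)\<close>-cell of \<open>K\<close> is a linear combination of
  \<open>d\<close>-cells lying in \<open>K\<close>. Hence, if \<open>L \<subseteq> K\<close> are both cell complexes for the same \<open>cdim\<close> and \<open>bd\<close>,
  then \<open>L\<close> is a subcomplex of \<open>K\<close>, i.e. closed under taking faces.
\<close>

definition cell_complex ::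
  "('c \<Rightarrow> nat) \<Rightarrow> ('c \<Rightarrow> 'c \<Rightarrow> 'k :: field) \<Rightarrow> 'c set \<Rightarrow> bool" where
  "cell_complex cdim bd K \<longleftrightarrow> finite K \<and>
     (\<forall>s\<in>K. \<forall>t. bd s t \<noteq> 0 \<longrightarrow> t \<in> K \<and> cdim s = Suc (cdim t)) \<and>
     (\<forall>s\<in>K. \<forall>u\<in>K. (\<Sum>t\<in>K. bd s t * bd t u) = 0)"

text \<open>
  Indices start at \<open>0\<close> throughout, as for library matrices: \<open>X i\<close> and \<open>\<sigma> i\<close>, for \<open>i < n\<close>, are the
  complex and the cell usually written $X_{i+1}$ and $\sigma_{i+1}$.
\<close>

definition filtered_cell_complex ::
  "nat \<Rightarrow> ('c \<Rightarrow> nat) \<Rightarrow> ('c \<Rightarrow> 'c \<Rightarrow> 'k :: field) \<Rightarrow> (nat \<Rightarrow> 'c set) \<Rightarrow> (nat \<Rightarrow> 'c) \<Rightarrow> bool" where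
  "filtered_cell_complex n cdim bd X \<sigma> \<longleftrightarrow> n \<ge> 1 \<and>
     (\<forall>i<n. cell_complex cdim bd (X i)) \<and>
     X 0 = {\<sigma> 0} \<and> cdim (\<sigma> 0) = 0 \<and>
     (\<forall>i. Suc i < n \<longrightarrow> \<sigma> (Suc i) \<notin> X i \<and> X (Suc i) = insert (\<sigma> (Suc i)) (X i))"

definition boundary_matrix ::
  "nat \<Rightarrow> ('c \<Rightarrow> 'c \<Rightarrow> 'k :: field) \<Rightarrow> (nat \<Rightarrow> 'c) \<Rightarrow> 'k mat" where
  "boundary_matrix n bd \<sigma> = mat n n (\<lambda>(i, j). bd (\<sigma> j) (\<sigma> i))"

lemma filtered_cell_complex_cells:
  assumes "filtered_cell_complex n cdim bd X \<sigma>" and "i < n"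
  shows "X i = \<sigma> ` {..i} \<and> inj_on \<sigma> {..i}"
  using assms(2)
proof (induction i)
  case 0
  then show ?case using assms(1) by (simp add: filtered_cell_complex_def)
next
  case (Suc i)
  then have "X i = \<sigma> ` {..i}" "inj_on \<sigma> {..i}" by auto
  moreover have "\<sigma> (Suc i) \<notin> X i" "X (Suc i) = insert (\<sigma> (Suc i)) (X i)"
    using assms(1) Suc.prems by (auto simp: filtered_cell_complex_def)
  ultimately show ?case by (auto simp: atMost_Suc)
qed

lemma boundary_matrix_strict_upper:
  assumes F: "filtered_cell_complex n cdim bd X \<sigma>" and "j \<le> i" "i < n"
  shows "boundary_matrix n bd \<sigma> $$ (i, j) = 0"
proof (rule ccontr)
  assume "\<not> ?thesis"
  then have nz: "bd (\<sigma> j) (\<sigma> i) \<noteq> 0" using assms by (simp add: boundary_matrix_def)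
  have j: "j < n" using assms by simp
  have "cell_complex cdim bd (X j)"
    using F j unfolding filtered_cell_complex_def by blast
  moreover have "\<sigma> j \<in> X j" using filtered_cell_complex_cells[OF F j] by auto
  ultimately have "\<sigma> i \<in> X j" "cdim (\<sigma> j) = Suc (cdim (\<sigma> i))"
    using nz unfolding cell_complex_def by blast+
  moreover obtain k where k: "k \<le> j" "\<sigma> i = \<sigma> k"
    using \<open>\<sigma> i \<in> X j\<close> filtered_cell_complex_cells[OF F j] by auto
  have "i = k"
    by (rule inj_onD[of \<sigma> "{..i}"])
      (use k assms filtered_cell_complex_cells[OF F \<open>i < n\<close>] in auto)
  then have "i = j" using k assms by simp
  ultimately show False by simp
qed

lemma boundary_matrix_boundary:
  assumes F: "filtered_cell_complex n cdim bd X \<sigma>" and j: "j < n"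
  shows "bd (\<sigma> j) t = (\<Sum>i<j. boundary_matrix n bd \<sigma> $$ (i, j) * (if \<sigma> i = t then 1 else 0))"
proof -
  note cells = filtered_cell_complex_cells[OF F j]
  have cc: "cell_complex cdim bd (X j)" "\<sigma> j \<in> X j"
    using F j cells unfolding filtered_cell_complex_def by blast+
  have eq: "(\<Sum>i<j. boundary_matrix n bd \<sigma> $$ (i, j) * (if \<sigma> i = t then 1 else 0))
      = (\<Sum>i<j. if \<sigma> i = t then bd (\<sigma> j) t else 0)"
    using j by (intro sum.cong) (auto simp: boundary_matrix_def)
  show ?thesis
  proof (cases "t \<in> \<sigma> ` {..<j}")
    case True
    then obtain k where k: "k < j" "t = \<sigma> k" by auto
    then have "\<sigma> i = t \<longleftrightarrow> i = k" if "i < j" for i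
      using cells that by (auto simp: inj_on_def)
    then have "(\<Sum>i<j. if \<sigma> i = t then bd (\<sigma> j) t else 0)
        = (\<Sum>i<j. if i = k then bd (\<sigma> j) t else 0)"
      by (intro sum.cong) auto
    then show ?thesis using eq k by simp
  next
    case False
    then have "(\<Sum>i<j. if \<sigma> i = t then bd (\<sigma> j) t else 0) = 0"
      by (intro sum.neutral) auto
    moreover have "bd (\<sigma> j) t = 0"
    proof (rule ccontr)
      assume nz: "bd (\<sigma> j) t \<noteq> 0"
      then have "t \<in> X j" "cdim (\<sigma> j) = Suc (cdim t)"
        using cc unfolding cell_complex_def by blast+
      then have "t = \<sigma> j" using False cells by (auto simp: le_less)
      then show False using \<open>cdim (\<sigma> j) = Suc (cdim t)\<close> by simp
    qed
    ultimately show ?thesis using eq by simp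
  qed
qed

lemma boundary_matrix_square_zero:
  assumes F: "filtered_cell_complex n cdim bd X \<sigma>"
  shows "boundary_matrix n bd \<sigma> * boundary_matrix n bd \<sigma> = 0\<^sub>m n n"
proof (rule eq_matI)
  fix i j assume "i < dim_row (0\<^sub>m n n :: 'b mat)" "j < dim_col (0\<^sub>m n n :: 'b mat)"
  then have ij: "i < n" "j < n" by auto
  define m where "m = n - 1"
  have n: "n = Suc m" using ij by (simp add: m_def)
  have cells: "X m = \<sigma> ` {..m}" "inj_on \<sigma> {..m}"
    using filtered_cell_complex_cells[OF F, of m] n by auto
  have "cell_complex cdim bd (X m)" using F n unfolding filtered_cell_complex_def by blast
  moreover have "\<sigma> i \<in> X m" "\<sigma> j \<in> X m" using ij n cells by auto
  ultimately have "(\<Sum>t\<in>X m. bd (\<sigma> j) t * bd t (\<sigma> i)) = 0"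
    unfolding cell_complex_def by blast
  then have "(\<Sum>k\<le>m. bd (\<sigma> j) (\<sigma> k) * bd (\<sigma> k) (\<sigma> i)) = 0"
    by (simp add: cells sum.reindex)
  then show "(boundary_matrix n bd \<sigma> * boundary_matrix n bd \<sigma>) $$ (i, j) = 0\<^sub>m n n $$ (i, j)"
    using ij n
    by (simp add: boundary_matrix_def scalar_prod_def atLeast0LessThan lessThan_Suc_atMost
        mult.commute)
qed (simp_all add: boundary_matrix_def)

definition low :: "'k :: zero mat \<Rightarrow> nat \<Rightarrow> nat option" where
  "low A j = (let S = {i. i < dim_row A \<and> A $$ (i, j) \<noteq> 0}
              in if S = {} then None else Some (Max S))"

text \<open>
  For a state \<open>(R, V)\<close>, \<open>reduce_column j p\<close> is the assignment \<open>R[j] := R[j] - c R[p]\<close>,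
  \<open>V[j] := V[j] - c V[p]\<close>, used in both algorithms. In the library, \<open>addcol a k l A\<close> adds \<open>a\<close> times
  column \<open>l\<close> of \<open>A\<close> to column \<open>k\<close>.
\<close>

definition reduce_column ::
  "nat \<Rightarrow> nat \<Rightarrow> 'k :: field mat \<times> 'k mat \<Rightarrow> 'k mat \<times> 'k mat" where
  "reduce_column j p = (\<lambda>(R, V).
     let c = R $$ (the (low R j), j) / R $$ (the (low R p), p)
     in (addcol (- c) j p R, addcol (- c) j p V))"

definition reducer :: "'k :: zero mat \<Rightarrow> nat \<Rightarrow> nat \<Rightarrow> bool" where
  "reducer R i j \<longleftrightarrow> j < i \<and> low R i \<noteq> None \<and> low R j = low R i"

text \<open>
  The inner loop of the column algorithm; the result is \<open>None\<close> iff it does not terminate. The choice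
  by \<open>SOME\<close> renders ``while there exists \<open>j < i\<close>'', which does not say which \<open>j\<close> is taken.
\<close>

definition reduce_fully ::
  "nat \<Rightarrow> 'k :: field mat \<times> 'k mat \<Rightarrow> ('k mat \<times> 'k mat) option" where
  "reduce_fully i = while_option (\<lambda>(R, V). \<exists>j. reducer R i j)
     (\<lambda>(R, V). reduce_column i (SOME j. reducer R i j) (R, V))"

definition column_algorithm :: "'k :: field mat \<Rightarrow> ('k mat \<times> 'k mat) option" where
  "column_algorithm D =
     fold (\<lambda>i s. Option.bind s (reduce_fully i)) [0..<dim_col D] (Some (D, 1\<^sub>m (dim_col D)))"

definition row_step :: "nat \<Rightarrow> 'k :: field mat \<times> 'k mat \<Rightarrow> 'k mat \<times> 'k mat" where
  "row_step i = (\<lambda>(R, V).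
     case filter (\<lambda>j. low R j = Some i) [0..<dim_col R] of
       [] \<Rightarrow> (R, V)
     | p # js \<Rightarrow> fold (\<lambda>j. reduce_column j p) js (R, V))"

definition row_algorithm :: "'k :: field mat \<Rightarrow> 'k mat \<times> 'k mat" where
  "row_algorithm D = fold row_step (rev [0..<dim_row D]) (D, 1\<^sub>m (dim_col D))"

end

theory Submission
  imports Defs
begin

text \<open>
  Let \<open>F\<close> be the output of the column algorithm. Its columns have pairwise distinct lows, and column
  \<open>j\<close> is obtained from the input by reducing with columns \<open>p < j\<close> of \<open>F\<close>; since the lows are distinct,
  at each moment at most one such reduction is possible, so the chain leading to \<open>F j\<close> is
  deterministic. When the row algorithm treats row \<open>i\<close>, all lows below that row are already distinct,
  and this forces the pivot \<open>p\<close> to be column \<open>p\<close> of \<open>F\<close>. Hence the row algorithm only moves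
  each column along its own chain, and once all lows are distinct every chain has reached its end.
\<close>

section \<open>Heights of vectors\<close>

text \<open>Shifting the low by one, with \<open>0\<close> for the zero vector, lets the undefined case be compared by \<open><\<close>.\<close>

definition height :: "'k :: zero vec \<Rightarrow> nat" where
  "height v = (let S = {i. i < dim_vec v \<and> v $ i \<noteq> 0} in if S = {} then 0 else Suc (Max S))"

lemma height_le:
  assumes "\<And>i. m \<le> i \<Longrightarrow> i < dim_vec v \<Longrightarrow> v $ i = 0"
  shows "height v \<le> m"
proof -
  have "Max {i. i < dim_vec v \<and> v $ i \<noteq> 0} \<in> {i. i < dim_vec v \<and> v $ i \<noteq> 0}"
    if "{i. i < dim_vec v \<and> v $ i \<noteq> 0} \<noteq> {}"
    using that by (intro Max_in) auto
  then show ?thesis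
    using assms by (fastforce simp: height_def Let_def not_less_eq_eq)
qed

lemma height_le_dim: "height v \<le> dim_vec v"
  by (rule height_le) simp

lemma nth_eq_0_if_height_le:
  assumes "height v \<le> i" "i < dim_vec v"
  shows "v $ i = 0"
proof (rule ccontr)
  assume "v $ i \<noteq> 0"
  then have i: "i \<in> {i. i < dim_vec v \<and> v $ i \<noteq> 0}" using assms by simp
  then have "i \<le> Max {i. i < dim_vec v \<and> v $ i \<noteq> 0}" by (intro Max_ge) auto
  moreover have "height v = Suc (Max {i. i < dim_vec v \<and> v $ i \<noteq> 0})"
    unfolding height_def Let_def using i by (subst if_not_P) blast+
  ultimately show False using assms by simp
qed

lemma nth_height_neq_0:
  assumes "0 < height v"
  shows "v $ (height v - 1) \<noteq> 0"
proof -
  have "{i. i < dim_vec v \<and> v $ i \<noteq> 0} \<noteq> {}"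
    using assms by (simp add: height_def Let_def split: if_splits)
  then have "Max {i. i < dim_vec v \<and> v $ i \<noteq> 0} \<in> {i. i < dim_vec v \<and> v $ i \<noteq> 0}"
    by (intro Max_in) auto
  then show ?thesis
    using \<open>{i. i < dim_vec v \<and> v $ i \<noteq> 0} \<noteq> {}\<close> by (auto simp: height_def Let_def)
qed

lemma low_conv_height:
  assumes "j < dim_col A"
  shows "low A j = (if height (col A j) = 0 then None else Some (height (col A j) - 1))"
proof -
  have "{i. i < dim_row A \<and> A $$ (i, j) \<noteq> 0} = {i. i < dim_vec (col A j) \<and> col A j $ i \<noteq> 0}"
    using assms by auto
  then show ?thesis by (simp add: low_def height_def Let_def)
qed

section \<open>Reductions of one column and chains of them\<close>

definition reduce_by :: "'k :: field vec \<times> 'k vec \<Rightarrow> 'k vec \<times> 'k vec \<Rightarrow> 'k vec \<times> 'k vec" where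
  "reduce_by x y =
     (let c = fst x $ (height (fst x) - 1) / fst y $ (height (fst y) - 1)
      in (- c \<cdot>\<^sub>v fst y + fst x, - c \<cdot>\<^sub>v snd y + snd x))"

text \<open>The coefficient cancels the entry at the common low, and both vectors vanish below it.
  The strict decrease makes the inner column loop terminate and removes reduced columns from the row
  being treated.\<close>

lemma height_reduce_by_less:
  assumes "dim_vec (fst y) = dim_vec (fst x)" "height (fst y) = height (fst x)" "0 < height (fst x)"
  shows "height (fst (reduce_by x y)) < height (fst x)"
proof -
  have "height (fst (reduce_by x y)) \<le> height (fst x) - 1"
  proof (rule height_le)
    fix i assume i: "height (fst x) - 1 \<le> i" "i < dim_vec (fst (reduce_by x y))"
    then have d: "i < dim_vec (fst x)" using assms by (simp add: reduce_by_def Let_def)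
    show "fst (reduce_by x y) $ i = 0"
    proof (cases "i = height (fst x) - 1")
      case True
      then show ?thesis
        using assms d nth_height_neq_0[of "fst y"] by (simp add: reduce_by_def Let_def)
    next
      case False
      then have "height (fst x) \<le> i" using i by simp
      then show ?thesis
        using assms d by (simp add: reduce_by_def Let_def nth_eq_0_if_height_le)
    qed
  qed
  then show ?thesis using assms by simp
qed

text \<open>\<open>F\<close> is a fixed family, in the end the output of the column algorithm, while
  the algorithms act on a changing state. This suffices because every column they reduce with is
  already final.\<close>

definition red_step ::
  "(nat \<Rightarrow> 'k :: field vec \<times> 'k vec) \<Rightarrow> nat \<Rightarrow> 'k vec \<times> 'k vec \<Rightarrow> 'k vec \<times> 'k vec \<Rightarrow> bool" where
  "red_step F j x y \<longleftrightarrow>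
     (\<exists>p<j. 0 < height (fst x) \<and> height (fst (F p)) = height (fst x) \<and> y = reduce_by x (F p))"

text \<open>The threshold \<open>i\<close> counts the rows that the row algorithm has yet to treat:
  collisions may survive only there. At \<open>0\<close> the only columns that may share a height
  are zero columns.\<close>

definition distinct_heights :: "nat \<Rightarrow> nat \<Rightarrow> (nat \<Rightarrow> 'k :: field vec \<times> 'k vec) \<Rightarrow> bool" where
  "distinct_heights i n F \<longleftrightarrow>
     (\<forall>p q. p < q \<and> q < n \<and> height (fst (F p)) = height (fst (F q)) \<longrightarrow> height (fst (F q)) \<le> i)"

text \<open>Chains for column \<open>j\<close> look only to its left, so they survive later changes
  of the state.\<close>

lemma red_step_cong:
  assumes "\<And>p. p < j \<Longrightarrow> F p = G p"
  shows "red_step F j = red_step G j"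
  using assms by (auto simp: red_step_def fun_eq_iff)

lemma red_step_deterministic:
  assumes "distinct_heights 0 n F" "j \<le> n" "red_step F j x y" "red_step F j x z"
  shows "y = z"
proof -
  obtain p q where p: "p < j" "height (fst (F p)) = height (fst x)" "y = reduce_by x (F p)"
    and q: "q < j" "height (fst (F q)) = height (fst x)" "z = reduce_by x (F q)"
    and "0 < height (fst x)"
    using assms by (auto simp: red_step_def)
  then have "\<not> p < q" "\<not> q < p"
    using assms(1,2) unfolding distinct_heights_def by (metis le_zero_eq less_le_trans neq0_conv)+
  then show ?thesis using p q by simp
qed

text \<open>As \<open>z\<close> is irreducible and \<open>x\<close> is not, the chain from
  \<open>x\<close> to \<open>z\<close> is nonempty, and by determinism its first step leads to
  \<open>y\<close>.\<close>

lemma red_steps_through: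
  assumes "distinct_heights 0 n F" "j \<le> n" "(red_step F j)\<^sup>*\<^sup>* x z" "red_step F j x y"
    and "\<And>y. \<not> red_step F j z y"
  shows "(red_step F j)\<^sup>*\<^sup>* y z"
  using assms(3)
proof (cases rule: converse_rtranclpE)
  case base
  then show ?thesis using assms by blast
next
  case (step y')
  then show ?thesis using red_step_deterministic[OF assms(1,2) assms(4)] by blast
qed

lemma red_steps_height:
  assumes "(red_step F j)\<^sup>*\<^sup>* x y" "dim_vec (fst x) = m" "\<And>p. p < j \<Longrightarrow> dim_vec (fst (F p)) = m"
  shows "height (fst y) \<le> height (fst x) \<and> dim_vec (fst y) = m"
  using assms(1)
proof induction
  case base
  then show ?case using assms by simp
next
  case (step y z)
  then obtain p where p: "p < j" "0 < height (fst y)" "height (fst (F p)) = height (fst y)"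
    "z = reduce_by y (F p)"
    by (auto simp: red_step_def)
  have "height (fst z) < height (fst y)"
    using p step assms(3)[OF p(1)] by (auto intro!: height_reduce_by_less)
  moreover have "dim_vec (fst z) = m"
    using p step by (simp add: reduce_by_def Let_def)
  ultimately show ?case using step by simp
qed

text \<open>
  If \<open>C k\<close> were not final, it could be reduced by some \<open>F p\<close> with \<open>p < k\<close>. Then \<open>C p\<close> has height at
  least that of \<open>C k\<close>, so it is final by induction and agrees with \<open>C k\<close> in height, a contradiction.
\<close>

lemma column_final:
  assumes steps: "\<And>k. k < n \<Longrightarrow> (red_step F k)\<^sup>*\<^sup>* (C k) (F k)"
    and dim: "\<And>k. k < n \<Longrightarrow> dim_vec (fst (C k)) = m" "\<And>k. k < n \<Longrightarrow> dim_vec (fst (F k)) = m"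
    and "k < n"
    and "\<And>p q. p < q \<Longrightarrow> q \<le> k \<Longrightarrow> height (fst (C p)) = height (fst (C q)) \<Longrightarrow>
      0 < height (fst (C k)) \<Longrightarrow> height (fst (C q)) < height (fst (C k))"
  shows "C k = F k"
  using assms(4,5)
proof (induction k rule: less_induct)
  case (less k)
  show ?case
  proof (rule ccontr)
    assume "C k \<noteq> F k"
    with steps[OF less.prems(1)] obtain p where p: "p < k" "0 < height (fst (C k))"
      "height (fst (F p)) = height (fst (C k))"
      by (cases rule: converse_rtranclpE) (auto simp: red_step_def)
    have n: "p < n" using p less.prems by simp
    have "height (fst (F p)) \<le> height (fst (C p))"
      using red_steps_height[OF steps[OF n] dim(1)[OF n]] dim n by simp
    then have ge: "height (fst (C k)) \<le> height (fst (C p))" using p by simp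
    have "C p = F p"
    \<comment> \<open>Collisions up to \<open>p\<close> lie below the height of \<open>C k\<close>,
      and \<open>C p\<close> is at least that high.\<close>
    proof (rule less.IH[OF p(1) n])
      fix a b assume "a < b" "b \<le> p" "height (fst (C a)) = height (fst (C b))"
      then have "height (fst (C b)) < height (fst (C k))"
        using less.prems(2)[of a b] p by simp
      then show "height (fst (C b)) < height (fst (C p))" using ge by simp
    qed
    then show False using less.prems(2)[of p k] p by simp
  qed
qed

section \<open>Matrix states as families of columns\<close>

text \<open>
  The columns of \<open>R\<close> and \<open>V\<close> are kept together: every operation acts on both, and is determined by \<open>R\<close>.
\<close>

definition cols_of :: "'k mat \<times> 'k mat \<Rightarrow> nat \<Rightarrow> 'k vec \<times> 'k vec" where
  "cols_of S j = (col (fst S) j, col (snd S) j)"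

definition states :: "nat \<Rightarrow> nat \<Rightarrow> nat \<Rightarrow> ('k mat \<times> 'k mat) set" where
  "states m m' n = carrier_mat m n \<times> carrier_mat m' n"

lemma dim_cols_of: "S \<in> states m m' n \<Longrightarrow> dim_vec (fst (cols_of S j)) = m"
  by (auto simp: states_def cols_of_def)

lemma low_cols_of:
  assumes "S \<in> states m m' n" "j < n"
  shows "low (fst S) j =
    (if height (fst (cols_of S j)) = 0 then None else Some (height (fst (cols_of S j)) - 1))"
  using assms by (auto simp: states_def cols_of_def low_conv_height)

lemma state_eqI:
  assumes "S \<in> states m m' n" "T \<in> states m m' n" "\<And>j. j < n \<Longrightarrow> cols_of S j = cols_of T j"
  shows "S = T"
proof (rule prod_eqI)
  show "fst S = fst T" by (rule mat_col_eqI) (use assms in \<open>auto simp: states_def cols_of_def\<close>)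
  show "snd S = snd T" by (rule mat_col_eqI) (use assms in \<open>auto simp: states_def cols_of_def\<close>)
qed

lemma reduce_column_states:
  assumes "S \<in> states m m' n"
  shows "reduce_column j p S \<in> states m m' n"
  using assms by (auto simp: states_def reduce_column_def Let_def split: prod.splits)

lemma cols_of_reduce_column:
  assumes S: "S \<in> states m m' n" and "j < n" "p < n" "k < n"
    and "low (fst S) j \<noteq> None" "low (fst S) p \<noteq> None"
  shows "cols_of (reduce_column j p S) k =
    (if k = j then reduce_by (cols_of S j) (cols_of S p) else cols_of S k)"
proof -
  obtain R V where RV: "S = (R, V)" "R \<in> carrier_mat m n" "V \<in> carrier_mat m' n"
    using S by (auto simp: states_def)
  \<comment> \<open>Definedness of the low makes \<open>the (low R q)\<close> a genuine row index,
    the one that \<open>reduce_by\<close> reads.\<close>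
  have l: "low R q = Some (height (col R q) - 1)" "height (col R q) - 1 < m"
    if "q < n" "low R q \<noteq> None" for q
    using that RV low_conv_height[of q R] height_le_dim[of "col R q"] by (auto split: if_splits)
  have addcol: "col (addcol a j p A) k = (if k = j then a \<cdot>\<^sub>v col A p + col A j else col A k)"
    if "A \<in> carrier_mat r n" for a r and A :: "'a mat"
    using that assms by (auto intro!: eq_vecI)
  show ?thesis
    using l[of j] l[of p] assms RV
    by (simp add: reduce_column_def cols_of_def Let_def reduce_by_def addcol)
qed

lemma reducer_conv_height:
  assumes "S \<in> states m m' n" "i < n"
  shows "reducer (fst S) i j \<longleftrightarrow> j < i \<and> 0 < height (fst (cols_of S i)) \<and>
    height (fst (cols_of S j)) = height (fst (cols_of S i))"
  using low_cols_of[OF assms] low_cols_of[OF assms(1), of j] assms(2)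
  by (auto simp: reducer_def split: if_splits)

section \<open>The column algorithm\<close>

lemma reduce_fully_Some:
  assumes S: "S \<in> states m m' n" and i: "i < n"
  obtains T where "reduce_fully i S = Some T" "T \<in> states m m' n"
    "\<And>k. k < n \<Longrightarrow> k \<noteq> i \<Longrightarrow> cols_of T k = cols_of S k"
    "(red_step (cols_of S) i)\<^sup>*\<^sup>* (cols_of S i) (cols_of T i)"
    "\<And>j. \<not> reducer (fst T) i j"
proof -
  \<comment> \<open>Only column \<open>i\<close> changes in the loop, so the chain can be stated
    with the columns of the initial state \<open>S\<close>.\<close>
  define P where "P T \<longleftrightarrow> T \<in> states m m' n \<and> (\<forall>k<n. k \<noteq> i \<longrightarrow> cols_of T k = cols_of S k) \<and>
    (red_step (cols_of S) i)\<^sup>*\<^sup>* (cols_of S i) (cols_of T i)" for T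
  define b where "b = (\<lambda>(R, V :: 'a mat). \<exists>j. reducer (R :: 'a mat) i j)"
  define c where
    "c = (\<lambda>(R, V :: 'a mat). reduce_column i (SOME j. reducer (R :: 'a mat) i j) (R, V))"
  have loop: "reduce_fully i S = while_option b c S"
    by (simp add: reduce_fully_def b_def c_def)
  have step: "P (c T) \<and> height (fst (cols_of (c T) i)) < height (fst (cols_of T i))"
    if "P T" "b T" for T
  proof -
    have T: "T \<in> states m m' n" using that by (simp add: P_def)
    \<comment> \<open>Which reducer is chosen is irrelevant: only the fact that it is one enters
      below.\<close>
    define j where "j = (SOME j. reducer (fst T) i j)"
    have red: "reducer (fst T) i j"
      unfolding j_def using that by (auto simp: b_def intro: someI split: prod.splits)
    then have h: "j < i" "0 < height (fst (cols_of T i))"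
      "height (fst (cols_of T j)) = height (fst (cols_of T i))"
      using reducer_conv_height[OF T i] by auto
    have cT: "c T = reduce_column i j T" by (simp add: c_def j_def split: prod.splits)
    have "cols_of (c T) k = (if k = i then reduce_by (cols_of T i) (cols_of T j) else cols_of T k)"
      if "k < n" for k
      unfolding cT using red h i that by (intro cols_of_reduce_column[OF T]) (auto simp: reducer_def)
    moreover have "cols_of T j = cols_of S j" using \<open>P T\<close> h i by (simp add: P_def)
    ultimately have "red_step (cols_of S) i (cols_of T i) (cols_of (c T) i)"
      and "\<forall>k<n. k \<noteq> i \<longrightarrow> cols_of (c T) k = cols_of T k"
      and "cols_of (c T) i = reduce_by (cols_of T i) (cols_of T j)"
      using h i unfolding red_step_def by auto
    then show ?thesis
      using \<open>P T\<close> h height_reduce_by_less[of "cols_of T j" "cols_of T i"]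
      by (auto simp: P_def cT reduce_column_states dim_cols_of[OF T]
          intro: rtranclp.rtrancl_into_rtrancl)
  qed
  have "P S" using S by (simp add: P_def)
  then obtain T where T: "while_option b c S = Some T"
    using measure_while_option_Some[of P b c "\<lambda>T. height (fst (cols_of T i))" S] step by blast
  have "P T" using while_option_rule[of P b c S T] step T \<open>P S\<close> by blast
  moreover have "\<not> b T" using while_option_stop[OF T] .
  ultimately show ?thesis
    using T by (intro that[of T]) (auto simp: loop P_def b_def split: prod.splits)
qed

lemma column_algorithm_Some:
  assumes D: "D \<in> carrier_mat m n"
  obtains S where "column_algorithm D = Some S" "S \<in> states m n n"
    "distinct_heights 0 n (cols_of S)"
    "\<And>j. j < n \<Longrightarrow> (red_step (cols_of S) j)\<^sup>*\<^sup>* (cols_of (D, 1\<^sub>m n) j) (cols_of S j)"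
proof -
  \<comment> \<open>Treated columns never change again, so their chains can be stated with the
    current state in place of the final one.\<close>
  have "\<exists>S. fold (\<lambda>i s. Option.bind s (reduce_fully i)) [0..<i] (Some (D, 1\<^sub>m n)) = Some S \<and>
      S \<in> states m n n \<and> distinct_heights 0 i (cols_of S) \<and>
      (\<forall>j<n. i \<le> j \<longrightarrow> cols_of S j = cols_of (D, 1\<^sub>m n) j) \<and>
      (\<forall>j<i. (red_step (cols_of S) j)\<^sup>*\<^sup>* (cols_of (D, 1\<^sub>m n) j) (cols_of S j))"
    if "i \<le> n" for i
    using that
  proof (induction i)
    case 0
    then show ?case using D by (simp add: states_def distinct_heights_def)
  next
    case (Suc i)
    then obtain S where S:
      "fold (\<lambda>i s. Option.bind s (reduce_fully i)) [0..<i] (Some (D, 1\<^sub>m n)) = Some S"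
      "S \<in> states m n n" "distinct_heights 0 i (cols_of S)"
      "\<forall>j<n. i \<le> j \<longrightarrow> cols_of S j = cols_of (D, 1\<^sub>m n) j"
      "\<forall>j<i. (red_step (cols_of S) j)\<^sup>*\<^sup>* (cols_of (D, 1\<^sub>m n) j) (cols_of S j)"
      by auto
    have i: "i < n" using Suc by simp
    obtain T where T: "reduce_fully i S = Some T" "T \<in> states m n n"
      "\<And>k. k < n \<Longrightarrow> k \<noteq> i \<Longrightarrow> cols_of T k = cols_of S k"
      "(red_step (cols_of S) i)\<^sup>*\<^sup>* (cols_of S i) (cols_of T i)"
      "\<And>j. \<not> reducer (fst T) i j"
      using reduce_fully_Some[OF S(2) i] by metis
    have eq: "red_step (cols_of T) j = red_step (cols_of S) j" if "j \<le> i" for j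
      using that i T(3) by (intro red_step_cong) simp
    have "distinct_heights 0 (Suc i) (cols_of T)"
      unfolding distinct_heights_def
    proof (intro allI impI, elim conjE)
      fix p q
      assume pq: "p < q" "q < Suc i"
        "height (fst (cols_of T p)) = height (fst (cols_of T q))"
      show "height (fst (cols_of T q)) \<le> 0"
      proof (cases "q = i")
        case True
        \<comment> \<open>A collision of a nonzero column \<open>i\<close> with an earlier column
          would be a reducer, contrary to the exit condition of the loop.\<close>
        then show ?thesis using T(5)[of p] reducer_conv_height[OF T(2) i] pq by auto
      next
        case False
        then show ?thesis using pq S(3) T(3)[of p] T(3)[of q] i
          unfolding distinct_heights_def by auto
      qed
    qed
    moreover have "(red_step (cols_of T) j)\<^sup>*\<^sup>* (cols_of (D, 1\<^sub>m n) j) (cols_of T j)"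
      if "j < Suc i" for j
      using that eq[of j] i S(4,5) T(3)[of j] T(4) by (cases "j = i") auto
    ultimately show ?case
      using S T by (intro exI[of _ T]) auto
  qed
  from this[of n] show ?thesis using that D by (auto simp: column_algorithm_def)
qed

section \<open>The row algorithm\<close>

lemma fold_reduce_column:
  assumes "S \<in> states m m' n" "distinct js" "p \<notin> set js" "p < n" "set js \<subseteq> {..<n}"
    and "\<And>j. j \<in> insert p (set js) \<Longrightarrow> low (fst S) j \<noteq> None"
  shows "fold (\<lambda>j. reduce_column j p) js S \<in> states m m' n \<and>
    (\<forall>k<n. cols_of (fold (\<lambda>j. reduce_column j p) js S) k =
       (if k \<in> set js then reduce_by (cols_of S k) (cols_of S p) else cols_of S k))"
  using assms
\<comment> \<open>The first reduction changes neither the pivot nor the remaining columns of the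
  list, so the sequential loop acts like a simultaneous one.\<close>
proof (induction js arbitrary: S)
  case Nil
  then show ?case by simp
next
  case (Cons j js)
  define T where "T = reduce_column j p S"
  have T: "T \<in> states m m' n" unfolding T_def using Cons.prems(1) by (rule reduce_column_states)
  have cols: "cols_of T k = (if k = j then reduce_by (cols_of S j) (cols_of S p) else cols_of S k)"
    if "k < n" for k
    unfolding T_def using Cons.prems that by (intro cols_of_reduce_column) auto
  have "low (fst T) k \<noteq> None" if "k \<in> insert p (set js)" for k
  proof -
    have "k < n" "k \<noteq> j" using that Cons.prems by auto
    then show ?thesis
      using that cols[of k] Cons.prems low_cols_of[OF T] low_cols_of[OF Cons.prems(1)]
      by (metis insertCI insertE list.simps(15))
  qed
  then have "fold (\<lambda>j. reduce_column j p) js T \<in> states m m' n \<and>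
    (\<forall>k<n. cols_of (fold (\<lambda>j. reduce_column j p) js T) k =
       (if k \<in> set js then reduce_by (cols_of T k) (cols_of T p) else cols_of T k))"
    using Cons.prems T by (intro Cons.IH) auto
  then show ?case using cols Cons.prems by (auto simp: T_def[symmetric])
qed

text \<open>Low \<open>i\<close> is height \<open>Suc i\<close>, so treating row \<open>i\<close>
  lowers the threshold by one. The chains towards \<open>F\<close> are needed to identify the pivot
  and are preserved because the pivot is final.\<close>

lemma row_step_invariant:
  assumes F: "distinct_heights 0 n F" "\<And>k. k < n \<Longrightarrow> dim_vec (fst (F k)) = m"
    and S: "S \<in> states m m' n" "distinct_heights (Suc i) n (cols_of S)"
    and steps: "\<And>k. k < n \<Longrightarrow> (red_step F k)\<^sup>*\<^sup>* (cols_of S k) (F k)"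
  shows "row_step i S \<in> states m m' n \<and> distinct_heights i n (cols_of (row_step i S)) \<and>
    (\<forall>k<n. (red_step F k)\<^sup>*\<^sup>* (cols_of (row_step i S) k) (F k))"
proof -
  have low_iff: "low (fst S) k = Some i \<longleftrightarrow> height (fst (cols_of S k)) = Suc i" if "k < n" for k
    using low_cols_of[OF S(1) that] by auto
  have dim: "dim_col (fst S) = n" using S by (auto simp: states_def)
  show ?thesis
  proof (cases "filter (\<lambda>j. low (fst S) j = Some i) [0..<n]")
    case Nil
    then have "height (fst (cols_of S k)) \<noteq> Suc i" if "k < n" for k
      using that low_iff by (auto simp: filter_empty_conv)
    then have "distinct_heights i n (cols_of S)"
      using S(2) unfolding distinct_heights_def by (metis le_SucE)
    moreover have "row_step i S = S"
      using Nil dim by (auto simp: row_step_def split: prod.splits)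
    ultimately show ?thesis using S steps by simp
  next
    case (Cons p js)
    have set: "insert p (set js) = {k. k < n \<and> height (fst (cols_of S k)) = Suc i}"
      using arg_cong[OF Cons, of set] low_iff by auto
    \<comment> \<open>Filtering keeps the list increasing, so \<open>p\<close> is the leftmost
      column of height \<open>Suc i\<close>.\<close>
    have "sorted (p # js)" "distinct (p # js)"
      unfolding Cons[symmetric] by (simp_all add: sorted_wrt_filter)
    then have js: "distinct js" "p \<notin> set js" "\<And>j. j \<in> set js \<Longrightarrow> p < j"
      by (auto simp: le_less)
    have pn: "p < n" "height (fst (cols_of S p)) = Suc i" using set by blast+
    define T where "T = row_step i S"
    have T_fold: "T = fold (\<lambda>j. reduce_column j p) js S"
      using Cons dim by (auto simp: T_def row_step_def split: prod.splits)
    have T: "T \<in> states m m' n" and cols: "\<And>k. k < n \<Longrightarrow> cols_of T k =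
        (if k \<in> set js then reduce_by (cols_of S k) (cols_of S p) else cols_of S k)"
      using fold_reduce_column[OF S(1) js(1,2)] set low_iff pn
      unfolding T_fold by blast+
    have height_js: "height (fst (cols_of T k)) \<le> i" if "k \<in> set js" for k
    proof -
      have "k < n" "height (fst (cols_of S k)) = Suc i" using that set by blast+
      then show ?thesis
        using that pn cols height_reduce_by_less[of "cols_of S p" "cols_of S k"]
        by (simp add: dim_cols_of[OF S(1)])
    qed
    have "distinct_heights i n (cols_of T)"
      unfolding distinct_heights_def
    \<comment> \<open>Columns that collide above \<open>i\<close> after the step were not reduced,
      so they collided before, at height \<open>Suc i\<close>. Of the columns at that height only
      the pivot remains.\<close>
    proof (intro allI impI, elim conjE, rule ccontr)
      fix a b
      assume ab: "a < b" "b < n" "height (fst (cols_of T a)) = height (fst (cols_of T b))"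
        "\<not> height (fst (cols_of T b)) \<le> i"
      then have "a \<notin> set js" "b \<notin> set js" using height_js[of a] height_js[of b] by auto
      then have eq: "cols_of T a = cols_of S a" "cols_of T b = cols_of S b" using ab cols by auto
      then have "height (fst (cols_of S b)) = Suc i" 
        using S(2) ab unfolding distinct_heights_def by (metis le_SucE)
      then have "a \<in> insert p (set js)" "b \<in> insert p (set js)"
        using ab eq unfolding set by auto
      then show False using \<open>a \<notin> set js\<close> \<open>b \<notin> set js\<close> ab by simp
    qed
    moreover have "cols_of S p = F p"
    \<comment> \<open>Collisions among columns up to \<open>p\<close> have height at most
      \<open>Suc i\<close>, and equality fails because no column left of \<open>p\<close> has that
      height.\<close>
    proof (rule column_final[OF steps dim_cols_of[OF S(1)] F(2) pn(1)])
      fix a b assume ab: "a < b" "b \<le> p" "height (fst (cols_of S a)) = height (fst (cols_of S b))"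
      then have "height (fst (cols_of S b)) \<le> Suc i"
        using S(2) pn unfolding distinct_heights_def by auto
      moreover have "a \<notin> insert p (set js)" using js(3)[of a] ab by auto
      then have "height (fst (cols_of S a)) \<noteq> Suc i" using ab pn unfolding set by auto
      ultimately show "height (fst (cols_of S b)) < height (fst (cols_of S p))"
        using ab pn by simp
    qed
    then have "(red_step F k)\<^sup>*\<^sup>* (cols_of T k) (F k)" if "k < n" for k
    proof (cases "k \<in> set js")
      case True
      then have k: "p < k" "height (fst (cols_of S k)) = Suc i" using js set by blast+
      have "red_step F k (cols_of S k) (cols_of T k)"
        using k pn cols that True \<open>cols_of S p = F p\<close> unfolding red_step_def by auto
      \<comment> \<open>Distinct heights in \<open>F\<close> leave no column to the left that could
        reduce \<open>F k\<close>, so the chain must pass through the step just made.\<close>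
      moreover have "\<not> red_step F k (F k) y" for y
        using F(1) that unfolding red_step_def distinct_heights_def by fastforce
      ultimately show ?thesis
        using red_steps_through[OF F(1) _ steps[OF that]] that by simp
    qed (use cols steps that in simp)
    ultimately show ?thesis using T by (simp add: T_def)
  qed
qed

lemma row_steps_invariant:
  assumes F: "distinct_heights 0 n F" "\<And>k. k < n \<Longrightarrow> dim_vec (fst (F k)) = m"
    and "S \<in> states m m' n" "distinct_heights i n (cols_of S)"
    and "\<forall>k<n. (red_step F k)\<^sup>*\<^sup>* (cols_of S k) (F k)"
  shows "fold row_step (rev [0..<i]) S \<in> states m m' n \<and>
    distinct_heights 0 n (cols_of (fold row_step (rev [0..<i]) S)) \<and>
    (\<forall>k<n. (red_step F k)\<^sup>*\<^sup>* (cols_of (fold row_step (rev [0..<i]) S) k) (F k))"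
  using assms(3-5)
proof (induction i arbitrary: S)
  case 0
  then show ?case by simp
next
  case (Suc i)
  then show ?case using row_step_invariant[OF F, of S m' i] by simp
qed

section \<open>Equality of the two outputs\<close>

theorem column_algorithm_eq_row_algorithm:
  "column_algorithm D = Some (row_algorithm D)"
proof -
  define m n where "m = dim_row D" and "n = dim_col D"
  have D: "D \<in> carrier_mat m n" by (simp add: m_def n_def)
  obtain S where S: "column_algorithm D = Some S" "S \<in> states m n n"
    "distinct_heights 0 n (cols_of S)"
    "\<And>j. j < n \<Longrightarrow> (red_step (cols_of S) j)\<^sup>*\<^sup>* (cols_of (D, 1\<^sub>m n) j) (cols_of S j)"
    using column_algorithm_Some[OF D] by metis
  have init: "(D, 1\<^sub>m n) \<in> states m n n" using D by (simp add: states_def)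
  \<comment> \<open>No height exceeds the number of rows, so initially the threshold
    \<open>m\<close> imposes no condition.\<close>
  have "distinct_heights m n (cols_of (D, 1\<^sub>m n))"
    using height_le_dim dim_cols_of[OF init] unfolding distinct_heights_def by metis
  then have row: "row_algorithm D \<in> states m n n"
    "distinct_heights 0 n (cols_of (row_algorithm D))"
    "\<And>k. k < n \<Longrightarrow> (red_step (cols_of S) k)\<^sup>*\<^sup>* (cols_of (row_algorithm D) k) (cols_of S k)"
    using row_steps_invariant[OF S(3) dim_cols_of[OF S(2)] init] S(4)
    unfolding row_algorithm_def m_def[symmetric] n_def[symmetric] by auto
  have "cols_of (row_algorithm D) k = cols_of S k" if "k < n" for k
  \<comment> \<open>In the row output colliding columns have height \<open>0\<close>, which is below
    any positive height, so every column is at the end of its chain.\<close>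
  proof (rule column_final[OF row(3) dim_cols_of[OF row(1)] dim_cols_of[OF S(2)] that])
    fix p q
    assume "p < q" "q \<le> k" "0 < height (fst (cols_of (row_algorithm D) k))"
      "height (fst (cols_of (row_algorithm D) p)) = height (fst (cols_of (row_algorithm D) q))"
    then show "height (fst (cols_of (row_algorithm D) q)) <
        height (fst (cols_of (row_algorithm D) k))"
      using row(2) that unfolding distinct_heights_def by fastforce
  qed
  then show ?thesis using S state_eqI[OF row(1) S(2)] by simp
qed

theorem theorem3p1:
  fixes n :: nat
    and cdim :: "'c \<Rightarrow> nat"
    and bd :: "'c \<Rightarrow> 'c \<Rightarrow> 'k :: field"
    and X :: "nat \<Rightarrow> 'c set"
    and \<sigma> :: "nat \<Rightarrow> 'c"
    and D :: "'k mat"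
  assumes "filtered_cell_complex n cdim bd X \<sigma>"
    and "D = boundary_matrix n bd \<sigma>"
  shows "\<exists>R\<^sub>c V\<^sub>c R\<^sub>r V\<^sub>r. column_algorithm D = Some (R\<^sub>c, V\<^sub>c) \<and> row_algorithm D = (R\<^sub>r, V\<^sub>r) \<and>
           R\<^sub>c = R\<^sub>r \<and> V\<^sub>c = V\<^sub>r"
  using column_algorithm_eq_row_algorithm[of D] by (cases "row_algorithm D") simp

end
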